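(* Let $\mathcal{T}$ be the Ammann set of $16$ Wang tiles over the $6$ colors $\{0,1,2,3,4,5\}$ listed in the context, and let $\mathcal{T}_{\mathrm{corner}}$ be the set of $44$ corner tiles over $6$ colors obtained from $\mathcal{T}$ by the horizontal translation method (the Lagae corner tile set). Then $\mathcal{T}_{\mathrm{corner}}$ is not aperiodic: it admits a periodic rectangular valid tiling.
   Context: A Wang tile is a quadruple of colors $(c^{\mathrm n},c^{\mathrm w},c^{\mathrm s},c^{\mathrm e})$ (north, west, south, east edges of a non-rotatable unit square). The Ammann set $\mathcal{T}$ consists of the following $16$ tiles, written $(c^{\mathrm n},c^{\mathrm w},c^{\mathrm s},c^{\mathrm e})$: $(0,0,1,1)$, $(4,0,3,0)$, $(2,1,5,1)$, $(4,1,2,0)$, $(3,1,5,0)$, $(2,2,3,3)$, $(5,2,3,2)$, $(3,2,3,4)$, $(1,2,1,5)$, $(5,5,2,2)$, $(3,3,4,4)$, $(1,3,0,5)$, $(2,5,2,3)$, $(2,3,4,3)$, $(1,4,0,2)$, $(0,4,0,3)$. A corner tile is a quadruple of colors $(c^{\mathrm{nw}},c^{\mathrm{sw}},c^{\mathrm{se}},c^{\mathrm{ne}})$ of the northwest, southwest, southeast and northeast corners of a non-rotatable unit square. Horizontal translation method: $$\mathcal{T}_{\mathrm{corner}}=\{(c_p^{\mathrm n},c_p^{\mathrm s},c_q^{\mathrm s},c_q^{\mathrm n}) : (p,q)\in\mathcal{T}^2,\ c_p^{\mathrm e}=c_q^{\mathrm w}\}.$$ A rectangular tiling by corner tiles is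 a map from $\{1,\dots,n_{\mathrm h}\}\times\{1,\dots,n_{\mathrm w}\}$ ($(i,j)$ = row $i$ counted downwards, column $j$ counted to the right; $n_{\mathrm h},n_{\mathrm w}\ge 1$) to the corner tile set (tiles may be reused). It is valid if the colors of the corners along the shared side of any two horizontally or vertically adjacent tiles coincide (for horizontal neighbors: $c^{\mathrm{ne}},c^{\mathrm{se}}$ of the left tile equal $c^{\mathrm{nw}},c^{\mathrm{sw}}$ of the right tile, respectively; for vertical neighbors: $c^{\mathrm{sw}},c^{\mathrm{se}}$ of the upper tile equal $c^{\mathrm{nw}},c^{\mathrm{ne}}$ of the lower tile, respectively). A valid rectangular tiling is periodic if the corner colors along the opposite sides of the rectangle also match (i.e., the matching rules also hold between the last and the first column of every row, and between the last and the first row of every column). A tile set is aperiodic if it admits a valid tiling of the infinite plane but admits no periodic rectangular valid tiling. *)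

theory Defs
  imports Main
begin

record 'c wang_tile =
  north :: 'c
  west :: 'c
  south :: 'c
  east :: 'c

text \<open>The field order is the order (north, west, south, east) of the quadruple notation.\<close>

definition wang :: "'c \<Rightarrow> 'c \<Rightarrow> 'c \<Rightarrow> 'c \<Rightarrow> 'c wang_tile" where
  "wang n w s e = \<lparr>north = n, west = w, south = s, east = e\<rparr>"

definition ammann :: "nat wang_tile set" where
  "ammann =
    {wang 0 0 1 1, wang 4 0 3 0, wang 2 1 5 1, wang 4 1 2 0,
     wang 3 1 5 0, wang 2 2 3 3, wang 5 2 3 2, wang 3 2 3 4,
     wang 1 2 1 5, wang 5 5 2 2, wang 3 3 4 4, wang 1 3 0 5,
     wang 2 5 2 3, wang 2 3 4 3, wang 1 4 0 2, wang 0 4 0 3}"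

record 'c corner_tile =
  nw :: 'c
  sw :: 'c
  se :: 'c
  ne :: 'c

definition horizontal_translation :: "'c wang_tile set \<Rightarrow> 'c corner_tile set" where
  "horizontal_translation T =
    {\<lparr>nw = north p, sw = south p, se = south q, ne = north q\<rparr> | p q.
       p \<in> T \<and> q \<in> T \<and> east p = west q}"

definition ammann_corner :: "nat corner_tile set" where
  "ammann_corner = horizontal_translation ammann"

definition h_match :: "'c corner_tile \<Rightarrow> 'c corner_tile \<Rightarrow> bool" where
  "h_match l r \<longleftrightarrow> ne l = nw r \<and> se l = sw r"

definition v_match :: "'c corner_tile \<Rightarrow> 'c corner_tile \<Rightarrow> bool" where
  "v_match u d \<longleftrightarrow> sw u = nw d \<and> se u = ne d"

text \<open>In a tiling \<open>f\<close>, the tile \<open>f i j\<close> sits in row \<open>i\<close> (counted downwards) and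
  column \<open>j\<close> (counted to the right). Rectangular tilings use the indices
  \<open>1..h\<close> and \<open>1..w\<close>; the values of \<open>f\<close> elsewhere are irrelevant.\<close>

definition valid_rectangular_tiling ::
    "'c corner_tile set \<Rightarrow> nat \<Rightarrow> nat \<Rightarrow> (nat \<Rightarrow> nat \<Rightarrow> 'c corner_tile) \<Rightarrow> bool" where
  "valid_rectangular_tiling S h w f \<longleftrightarrow>
    h \<ge> 1 \<and> w \<ge> 1 \<and>
    (\<forall>i\<in>{1..h}. \<forall>j\<in>{1..w}. f i j \<in> S) \<and>
    (\<forall>i\<in>{1..h}. \<forall>j\<in>{1..<w}. h_match (f i j) (f i (j + 1))) \<and>
    (\<forall>i\<in>{1..<h}. \<forall>j\<in>{1..w}. v_match (f i j) (f (i + 1) j))"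

definition periodic_rectangular_tiling ::
    "'c corner_tile set \<Rightarrow> nat \<Rightarrow> nat \<Rightarrow> (nat \<Rightarrow> nat \<Rightarrow> 'c corner_tile) \<Rightarrow> bool" where
  "periodic_rectangular_tiling S h w f \<longleftrightarrow>
    valid_rectangular_tiling S h w f \<and>
    (\<forall>i\<in>{1..h}. h_match (f i w) (f i 1)) \<and>
    (\<forall>j\<in>{1..w}. v_match (f h j) (f 1 j))"

definition valid_plane_tiling ::
    "'c corner_tile set \<Rightarrow> (int \<Rightarrow> int \<Rightarrow> 'c corner_tile) \<Rightarrow> bool" where
  "valid_plane_tiling S f \<longleftrightarrow>
    (\<forall>i j. f i j \<in> S \<and> h_match (f i j) (f i (j + 1)) \<and> v_match (f i j) (f (i + 1) j))"

definition aperiodic :: "'c corner_tile set \<Rightarrow> bool" where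
  "aperiodic S \<longleftrightarrow>
    (\<exists>f. valid_plane_tiling S f) \<and>
    \<not> (\<exists>h w f. periodic_rectangular_tiling S h w f)"

lemma card_ammann: "card ammann = 16"
  by (simp add: ammann_def wang_def)

lemma ammann_colors:
  "t \<in> ammann \<Longrightarrow> {north t, west t, south t, east t} \<subseteq> {0, 1, 2, 3, 4, 5}"
  by (auto simp: ammann_def wang_def)

definition corner :: "'c \<Rightarrow> 'c \<Rightarrow> 'c \<Rightarrow> 'c \<Rightarrow> 'c corner_tile" where
  "corner a b c d = \<lparr>nw = a, sw = b, se = c, ne = d\<rparr>"

lemma corner_eq_iff [simp]:
  "corner a b c d = corner a' b' c' d' \<longleftrightarrow> a = a' \<and> b = b' \<and> c = c' \<and> d = d'"
  by (simp add: corner_def)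

lemma horizontal_translation_eq_Union:
  "horizontal_translation T =
    (\<Union>p\<in>T. \<Union>q\<in>T. if east p = west q
       then {corner (north p) (south p) (south q) (north q)} else {})"
  unfolding horizontal_translation_def corner_def by (auto split: if_splits)

lemma ammann_corner_eq:
  "ammann_corner =
    {corner 0 1 5 2, corner 0 1 2 4, corner 0 1 5 3, corner 4 3 1 0,
     corner 4 3 3 4, corner 2 5 5 2, corner 2 5 2 4, corner 2 5 5 3,
     corner 4 2 1 0, corner 4 2 3 4, corner 3 5 1 0, corner 3 5 3 4,
     corner 2 3 4 3, corner 2 3 0 1, corner 2 3 4 2, corner 5 3 3 2,
     corner 5 3 3 5, corner 5 3 3 3, corner 5 3 1 1, corner 3 3 0 1,
     corner 3 3 0 0, corner 1 1 2 5, corner 1 1 2 2, corner 5 2 3 2,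
     corner 5 2 3 5, corner 5 2 3 3, corner 5 2 1 1, corner 3 4 0 1,
     corner 3 4 0 0, corner 1 0 2 5, corner 1 0 2 2, corner 2 2 4 3,
     corner 2 2 0 1, corner 2 2 4 2, corner 2 4 4 3, corner 2 4 0 1,
     corner 2 4 4 2, corner 1 0 3 2, corner 1 0 3 5, corner 1 0 3 3,
     corner 1 0 1 1, corner 0 0 4 3, corner 0 0 0 1, corner 0 0 4 2}"
  (is "_ = ?R")
proof -
  have "ammann_corner \<subseteq> ?R"
    unfolding ammann_corner_def horizontal_translation_eq_Union
    by (simp add: ammann_def wang_def)
  moreover have "?R \<subseteq> ammann_corner"
    unfolding ammann_corner_def horizontal_translation_eq_Union
    by (simp add: ammann_def wang_def)
  ultimately show ?thesis
    by (rule subset_antisym)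
qed

lemma card_ammann_corner: "card ammann_corner = 44"
  unfolding ammann_corner_eq by simp

lemma ammann_corner_colors:
  "t \<in> ammann_corner \<Longrightarrow> {nw t, sw t, se t, ne t} \<subseteq> {0, 1, 2, 3, 4, 5}"
  unfolding ammann_corner_eq by (auto simp: corner_def)

end

theory Submission
  imports Defs
begin

text \<open>A corner tile remembers only the vertical colors of its two Wang tiles, so horizontal
  neighbors may come from pairs \<open>(p, q)\<close> and \<open>(q', r)\<close> with \<open>q \<noteq> q'\<close> that agree north and
  south. The Wang tiles \<open>(1, 4, 0, 2)\<close> and \<open>(1, 3, 0, 5)\<close> are such a pair: in the last row of the
  \<open>3 \<times> 2\<close> torus below they share a column, next to \<open>(2, 2, 3, 3)\<close>. The other two rows come from
  periodic rows of Wang tiles.\<close>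

definition lagae_torus :: "nat \<Rightarrow> nat \<Rightarrow> nat corner_tile" where
  "lagae_torus i j =
    [[corner 0 0 4 3, corner 3 4 0 0],
     [corner 0 1 2 4, corner 4 2 1 0],
     [corner 1 0 3 2, corner 2 3 0 1]] ! (i - 1) ! (j - 1)"

text \<open>The torus has six corners, in two columns reading 0, 0, 1 and 3, 4, 2 downwards. All
  tiles take their colors cyclically from this grid, so every side matches.\<close>

lemma periodic_lagae_torus:
  "periodic_rectangular_tiling ammann_corner 3 2 lagae_torus"
proof -
  have "{1..3} = {1, 2, 3::nat}" "{1..2} = {1, 2::nat}"
    "{1..<3} = {1, 2::nat}" "{1..<2} = {1::nat}"
    by auto
  then show ?thesis
    unfolding periodic_rectangular_tiling_def valid_rectangular_tiling_def ammann_corner_eq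
    \<comment> \<open>While \<open>corner\<close> stays folded, \<open>corner_eq_iff\<close> decides
      membership among the 44 tiles; only the matching conditions need \<open>corner_def\<close>, to
      read off fields.\<close>
    by (simp add: lagae_torus_def h_match_def v_match_def) (simp add: corner_def)
qed

theorem mainTheorem1:
  shows "\<not> aperiodic ammann_corner \<and>
    (\<exists>h w f. periodic_rectangular_tiling ammann_corner h w f)"
  unfolding aperiodic_def using periodic_lagae_torus by blast

end
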